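(* Let $\mathcal{D}$ be the set of all partitions into distinct parts (including the empty partition) and let $\ell(\lambda)$ denote the number of parts of $\lambda$. Then, as formal power series in $q$ and $z$, $$\sum_{\substack{\lambda\in\mathcal{D}\\ \ell(\lambda)\equiv 0\text{ or }3 \pmod 4}} z^{\lambda_1}q^{\lambda_1+\lambda_5+\lambda_9+\cdots}=1+\sum_{n=1}^\infty\frac{q^{\binom{2n+1}{2}}z^{4n-1}}{(qz;q)_n^4}$$ and $$\sum_{\substack{\lambda\in\mathcal{D}\\ \ell(\lambda)\equiv 1\text{ or }2 \pmod 4}} z^{\lambda_1}q^{\lambda_1+\lambda_5+\lambda_9+\cdots}=\sum_{n=1}^\infty\frac{q^{\binom{2n}{2}}z^{4n-3}}{(qz;q)_n^2\,(qz;q)_{n-1}^2}.$$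
   Context: A partition is a weakly decreasing sequence of nonnegative integers $\lambda=(\lambda_1,\lambda_2,\dots)$, eventually zero; $\lambda_i=0$ beyond the last part; it has distinct parts if no nonzero value is repeated. The $q$-Pochhammer symbol is $(a;q)_n=\prod_{k=0}^{n-1}(1-aq^k)$ for integers $n\ge0$. *)

theory Defs
  imports "HOL-Analysis.Analysis" "HOL-Computational_Algebra.Formal_Power_Series"
begin

text \<open>Sequences are indexed from 0, so the part written \<open>\<lambda>\<^sub>i\<close> on paper (\<open>i \<ge> 1\<close>) is \<open>p (i - 1)\<close>.\<close>

definition is_partition :: "(nat \<Rightarrow> nat) \<Rightarrow> bool" where
  "is_partition p \<longleftrightarrow> antimono p \<and> (\<exists>N. \<forall>i\<ge>N. p i = 0)"

definition distinct_partitions :: "(nat \<Rightarrow> nat) set" where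
  "distinct_partitions = {p. is_partition p \<and> (\<forall>i j. p i = p j \<and> p i \<noteq> 0 \<longrightarrow> i = j)}"

definition num_parts :: "(nat \<Rightarrow> nat) \<Rightarrow> nat" where
  "num_parts p = card {i. p i \<noteq> 0}"

text \<open>The sum \<open>\<lambda>\<^sub>1 + \<lambda>\<^sub>5 + \<lambda>\<^sub>9 + \<dots>\<close>; it is restricted to its nonzero terms because
  \<open>sum\<close> is 0 over an infinite index set.\<close>

definition every_fourth_sum :: "(nat \<Rightarrow> nat) \<Rightarrow> nat" where
  "every_fourth_sum p = (\<Sum>k | p (4 * k) \<noteq> 0. p (4 * k))"

definition qpoch :: "'a::comm_ring_1 \<Rightarrow> 'a \<Rightarrow> nat \<Rightarrow> 'a" where
  "qpoch a q n = (\<Prod>k<n. 1 - a * q ^ k)"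

text \<open>Formal power series in \<open>q\<close> and \<open>z\<close> are series in \<open>z\<close> whose coefficients are series in \<open>q\<close>.
  The topology of the outer \<open>fps\<close> type is the \<open>z\<close>-adic one, in which a sum converges iff
  each coefficient of a power of \<open>z\<close> is eventually constant.\<close>

definition qvar :: "rat fps fps" where
  "qvar = fps_const fps_X"

definition zvar :: "rat fps fps" where
  "zvar = fps_X"

text \<open>The denominators below have constant term 1 in \<open>z\<close>, so division by them is division by a
  unit.\<close>

lemma qpoch_qz_nth_0: "fps_nth (qpoch (qvar * zvar) qvar n) 0 = 1"
proof -
  have "fps_nth (\<Prod>k<n. 1 - qvar * zvar * qvar ^ k) 0 = 1"
    by (induction n) (simp_all add: zvar_def)
  thus ?thesis by (simp add: qpoch_def)
qed

lemma divide_mult_cancel_const_1: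
  fixes f g :: "rat fps fps"
  assumes "fps_nth g 0 = 1"
  shows "f / g * g = f"
proof -
  have "subdegree g = 0"
    using assms by (intro subdegree_eq_0) simp
  moreover from this have "unit_factor g = g"
    by simp
  moreover have "inverse (1 :: rat fps) = 1"
    using inverse_mult_eq_1[of "1 :: rat fps"] by simp
  then have "inverse g * g = 1"
    using fps_left_inverse'[of "inverse (fps_nth g 0)" g] assms by (simp only: fps_inverse_def) simp
  ultimately show ?thesis
    by (simp add: fps_divide_def mult.assoc)
qed

end

theory Submission
  imports Defs
begin

text \<open>
  Reading a partition into \<open>l\<close> distinct parts by columns, a column of height \<open>l\<close> contributes
  \<open>z q\<^sup>c\<close> with \<open>c = \<lceil>l/4\<rceil>\<close>, and removing it leaves a partition into \<open>l\<close> or \<open>l - 1\<close> distinct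
  parts. Hence the generating function \<open>F l\<close> of the partitions into \<open>l\<close> distinct parts satisfies
  \<open>F l = z q\<^sup>c (F l + F (l - 1))\<close>. For the four consecutive values \<open>4n+1, \<dots>, 4n+4\<close> of \<open>l\<close> the
  exponent \<open>c\<close> is constantly \<open>n + 1\<close>, and adding the recurrences in pairs gives the two
  numerators.
\<close>

unbundle no vec_syntax
unbundle fps_syntax

section \<open>Coefficientwise convergence of sums of power series\<close>

text \<open>A sum converges adically once only finitely many terms reach each coefficient.
  \<open>B m\<close> may overestimate those terms, so their exact set is never computed.\<close>

lemma has_sum_fps_supersetI:
  fixes f :: "'a \<Rightarrow> 'b::ab_group_add fps"
  assumes fin: "\<And>m. finite (B m)" and sub: "\<And>m. B m \<subseteq> A"
    and zero: "\<And>m a. a \<in> A - B m \<Longrightarrow> f a $ m = 0"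
    and sum: "\<And>m. (\<Sum>a\<in>B m. f a $ m) = s $ m"
  shows "(f has_sum s) A"
proof (rule has_sum_fpsI)
  fix m
  have supp: "{a \<in> A. f a $ m \<noteq> 0} = {a \<in> B m. f a $ m \<noteq> 0}"
    using sub zero by blast
  show "finite {a \<in> A. f a $ m \<noteq> 0}"
    unfolding supp using fin by simp
  show "s $ m = (\<Sum>a | a \<in> A \<and> f a $ m \<noteq> 0. f a $ m)"
    unfolding supp sum[symmetric] using fin by (intro sum.mono_neutral_right) auto
qed

section \<open>Distinct partitions with given number of parts and largest part\<close>

text \<open>For \<open>l > 0\<close> the strict inequality at \<open>i = l - 1\<close> compares the
  last part with \<open>p l = 0\<close>, which makes that part positive.\<close>

definition strict_parts :: "nat \<Rightarrow> nat \<Rightarrow> (nat \<Rightarrow> nat) set" where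
  "strict_parts l m = {p. (\<forall>i\<ge>l. p i = 0) \<and> (\<forall>i<l. p (Suc i) < p i) \<and> p 0 = m}"

lemma strict_parts_nonzero_iff:
  assumes "p \<in> strict_parts l m"
  shows "p i \<noteq> 0 \<longleftrightarrow> i < l"
  using assms unfolding strict_parts_def
  by (metis (mono_tags, lifting) gr_implies_not0 linorder_not_less mem_Collect_eq)

text \<open>A weakly decreasing sequence without repeated nonzero values decreases strictly down to
  its first zero, whose index is the number of parts.\<close>

lemma strict_parts_eq:
  "strict_parts l m = {p \<in> distinct_partitions. num_parts p = l \<and> p 0 = m}"
proof (intro set_eqI iffI)
  fix p assume p: "p \<in> strict_parts l m"
  have dec: "p (Suc i) \<le> p i" for i
    using p by (cases "i < l") (auto simp: strict_parts_def less_imp_le)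
  then have anti: "antimono p"
    by (simp add: antimono_iff_le_Suc)
  have lt: "p j < p i" if "i < j" "i < l" for i j
  proof -
    have "p j \<le> p (Suc i)" using antimonoD[OF anti, of "Suc i" j] that by simp
    also have "\<dots> < p i" using p that by (auto simp: strict_parts_def)
    finally show ?thesis .
  qed
  have "i = j" if "p i = p j" "p i \<noteq> 0" for i j
    using that lt[of i j] lt[of j i] strict_parts_nonzero_iff[OF p]
    by (metis less_irrefl linorder_neqE_nat)
  moreover have "num_parts p = l"
    using strict_parts_nonzero_iff[OF p] by (simp add: num_parts_def)
  moreover have "\<exists>N. \<forall>i\<ge>N. p i = 0"
    using p by (auto simp: strict_parts_def)
  moreover have "p 0 = m"
    using p by (simp add: strict_parts_def)
  ultimately show "p \<in> {p \<in> distinct_partitions. num_parts p = l \<and> p 0 = m}"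
    using anti unfolding distinct_partitions_def is_partition_def by blast
next
  fix p assume "p \<in> {p \<in> distinct_partitions. num_parts p = l \<and> p 0 = m}"
  then have anti: "antimono p" and ev: "\<exists>N. \<forall>i\<ge>N. p i = 0"
    and inj: "\<And>i j. p i = p j \<Longrightarrow> p i \<noteq> 0 \<Longrightarrow> i = j"
    and l: "num_parts p = l" and m: "p 0 = m"
    by (auto simp: distinct_partitions_def is_partition_def)
  \<comment> \<open>By monotonicity the nonzero entries fill exactly the indices below the first
    zero, so \<open>N\<close> counts them.\<close>
  define N where "N = (LEAST N. p N = 0)"
  from ev obtain K where "p K = 0"
    by blast
  then have N0: "p N = 0"
    unfolding N_def by (rule LeastI)
  have iff: "p i \<noteq> 0 \<longleftrightarrow> i < N" for i
  proof
    assume "p i \<noteq> 0"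
    then show "i < N"
      using antimonoD[OF anti, of N i] N0 by (cases "N \<le> i") auto
  next
    assume "i < N"
    then show "p i \<noteq> 0"
      unfolding N_def by (rule not_less_Least)
  qed
  then have "N = l"
    using l by (simp add: num_parts_def)
  moreover have "p (Suc i) < p i" if "i < N" for i
    using antimonoD[OF anti, of i "Suc i"] inj[of i "Suc i"] iff[of i] that by fastforce
  moreover have "p i = 0" if "i \<ge> N" for i
    using iff[of i] that by auto
  ultimately show "p \<in> strict_parts l m"
    using m by (simp add: strict_parts_def)
qed

lemma strict_parts_0_0: "strict_parts 0 0 = {\<lambda>_. 0}"
  by (auto simp: strict_parts_def)

lemma strict_parts_0_Suc: "strict_parts 0 (Suc m) = {}"
  by (auto simp: strict_parts_def)

lemma strict_parts_Suc_0: "strict_parts (Suc l) 0 = {}"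
  by (auto simp: strict_parts_def)

section \<open>Adding and removing a column\<close>

definition add_column :: "nat \<Rightarrow> (nat \<Rightarrow> nat) \<Rightarrow> nat \<Rightarrow> nat" where
  "add_column l p i = (if i < l then Suc (p i) else 0)"

text \<open>Lowering every part by one keeps all parts or loses only the last, since at most one of
  several distinct parts equals 1; these cases are the two sets of the union. The inverse is
  truncated subtraction, which fixes zeros.\<close>

lemma bij_betw_add_column:
  "bij_betw (add_column (Suc l)) (strict_parts (Suc l) m \<union> strict_parts l m)
     (strict_parts (Suc l) (Suc m))"
proof (rule bij_betw_byWitness[where f' = "\<lambda>p i. p i - 1"])
  show "\<forall>p\<in>strict_parts (Suc l) m \<union> strict_parts l m. (\<lambda>i. add_column (Suc l) p i - 1) = p"
    by (auto simp: strict_parts_def add_column_def fun_eq_iff)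
  show "\<forall>p\<in>strict_parts (Suc l) (Suc m). add_column (Suc l) (\<lambda>i. p i - 1) = p"
  proof
    fix p assume p: "p \<in> strict_parts (Suc l) (Suc m)"
    show "add_column (Suc l) (\<lambda>i. p i - 1) = p"
      using strict_parts_nonzero_iff[OF p] by (auto simp: add_column_def fun_eq_iff)
  qed
  show "add_column (Suc l) ` (strict_parts (Suc l) m \<union> strict_parts l m)
      \<subseteq> strict_parts (Suc l) (Suc m)"
    by (auto simp: strict_parts_def add_column_def)
  show "(\<lambda>p i. p i - 1) ` strict_parts (Suc l) (Suc m)
      \<subseteq> strict_parts (Suc l) m \<union> strict_parts l m"
  proof clarify
    fix p assume p: "p \<in> strict_parts (Suc l) (Suc m)"
      and not: "(\<lambda>i. p i - 1) \<notin> strict_parts l m"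
    have nz: "p i \<noteq> 0 \<longleftrightarrow> i < Suc l" for i
      by (rule strict_parts_nonzero_iff[OF p])
    have dec: "p (Suc i) < p i" if "i < Suc l" for i
      using p that by (auto simp: strict_parts_def)
    have m: "p 0 = Suc m" and z: "\<And>i. i \<ge> Suc l \<Longrightarrow> p i = 0"
      using p by (auto simp: strict_parts_def)
    have step: "p (Suc i) - 1 < p i - 1" if "i < l" for i
      using dec[of i] nz[of "Suc i"] that by simp
    \<comment> \<open>\<open>p l\<close> is the smallest part; were it 1, lowering would leave
      \<open>l\<close> parts, which \<open>not\<close> excludes.\<close>
    have "p l \<noteq> 1"
    proof
      assume "p l = 1"
      then have "p i - 1 = 0" if "i \<ge> l" for i
        using z[of i] that by (cases "i = l") auto
      then show False
        using not step m by (auto simp: strict_parts_def)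
    qed
    \<comment> \<open>At \<open>i = l\<close> the claim is \<open>0 < p l - 1\<close>, which is
      where \<open>p l \<noteq> 1\<close> enters.\<close>
    then have "p (Suc i) - 1 < p i - 1" if "i < Suc l" for i
      using step[of i] that nz[of l] z[of "Suc l"] by (cases "i = l") auto
    then show "(\<lambda>i. p i - 1) \<in> strict_parts (Suc l) m"
      using z m by (auto simp: strict_parts_def)
  qed
qed

lemma finite_strict_parts: "finite (strict_parts l m)"
proof (induction m arbitrary: l)
  case 0
  show ?case by (cases l) (simp_all add: strict_parts_0_0 strict_parts_Suc_0)
next
  case (Suc m)
  show ?case
  proof (cases l)
    case 0
    then show ?thesis by (simp add: strict_parts_0_Suc)
  next
    case (Suc k)
    then show ?thesis
      using bij_betw_finite[OF bij_betw_add_column[of k m]] Suc.IH by simp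
  qed
qed

text \<open>Column removal lowers the largest part by one and the length by at most one. This bound
  makes the sums over lengths finite in each power of z.\<close>

lemma strict_parts_empty: "m < l \<Longrightarrow> strict_parts l m = {}"
proof (induction m arbitrary: l)
  case 0
  then show ?case by (cases l) (simp_all add: strict_parts_Suc_0)
next
  case (Suc m)
  then obtain k where "l = Suc k" "m < k" by (cases l) auto
  then show ?case
    using bij_betw_add_column[of k m] Suc.IH[of k] Suc.IH[of "Suc k"] by (simp add: bij_betw_def)
qed

section \<open>Effect of a column on the weight\<close>

text \<open>\<open>(l + 3) div 4\<close> is l/4 rounded up, the number of indices 0, 4, 8, ... below
  \<open>l\<close>. The range depends on \<open>l\<close> alone and may contain zero terms.\<close>

lemma every_fourth_sum_eq:
  assumes "\<forall>i\<ge>l. p i = 0"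
  shows "every_fourth_sum p = (\<Sum>k<(l + 3) div 4. p (4 * k))"
proof -
  have "4 * k < l \<longleftrightarrow> k < (l + 3) div 4" for k
    by linarith
  then have "p (4 * k) \<noteq> 0 \<Longrightarrow> k < (l + 3) div 4" for k
    using assms by (metis linorder_not_less)
  then show ?thesis
    unfolding every_fourth_sum_def by (intro sum.mono_neutral_left) auto
qed

text \<open>Asking only for zeros from \<open>l\<close> on covers partitions into \<open>l\<close>
  and into \<open>l - 1\<close> parts alike, so both halves of the bijection gain the same power of
  q.\<close>

lemma every_fourth_sum_add_column:
  assumes "\<forall>i\<ge>l. p i = 0"
  shows "every_fourth_sum (add_column l p) = every_fourth_sum p + (l + 3) div 4"
proof -
  have "every_fourth_sum (add_column l p) = (\<Sum>k<(l + 3) div 4. add_column l p (4 * k))"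
    by (rule every_fourth_sum_eq) (simp add: add_column_def)
  also have "\<dots> = (\<Sum>k<(l + 3) div 4. p (4 * k) + 1)"
    by (intro sum.cong) (auto simp: add_column_def)
  also have "\<dots> = every_fourth_sum p + (l + 3) div 4"
    by (simp only: every_fourth_sum_eq[OF assms] sum.distrib) simp
  finally show ?thesis .
qed

section \<open>Generating functions by length and their recurrence\<close>

definition strict_gf :: "nat \<Rightarrow> rat fps fps" where
  "strict_gf l = Abs_fps (\<lambda>m. \<Sum>p\<in>strict_parts l m. fps_X ^ every_fourth_sum p)"

lemma strict_gf_nth:
  "strict_gf l $ m = (\<Sum>p\<in>strict_parts l m. fps_X ^ every_fourth_sum p)"
  by (simp add: strict_gf_def)

lemma strict_gf_nth_eq_0: "m < l \<Longrightarrow> strict_gf l $ m = 0"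
  by (simp add: strict_gf_nth strict_parts_empty)

lemma strict_gf_0: "strict_gf 0 = 1"
proof (rule fps_ext)
  fix m
  show "strict_gf 0 $ m = 1 $ m"
    by (cases m) (simp_all add: strict_gf_nth strict_parts_0_0 strict_parts_0_Suc every_fourth_sum_def)
qed

lemma strict_gf_nth_Suc:
  "strict_gf (Suc l) $ Suc m = fps_X ^ ((l + 4) div 4) * (strict_gf (Suc l) $ m + strict_gf l $ m)"
proof -
  let ?w = "\<lambda>p. fps_X ^ every_fourth_sum p :: rat fps"
  have "strict_gf (Suc l) $ Suc m
      = (\<Sum>p\<in>strict_parts (Suc l) m \<union> strict_parts l m. ?w (add_column (Suc l) p))"
    unfolding strict_gf_nth by (rule sum.reindex_bij_betw[OF bij_betw_add_column, symmetric])
  also have "\<dots> = (\<Sum>p\<in>strict_parts (Suc l) m \<union> strict_parts l m. fps_X ^ ((l + 4) div 4) * ?w p)"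
  proof (rule sum.cong[OF refl])
    fix p assume "p \<in> strict_parts (Suc l) m \<union> strict_parts l m"
    then have "\<forall>i\<ge>Suc l. p i = 0"
      by (auto simp: strict_parts_def)
    from every_fourth_sum_add_column[OF this]
    have "every_fourth_sum (add_column (Suc l) p) = (l + 4) div 4 + every_fourth_sum p"
      by (simp add: add.commute)
    then show "?w (add_column (Suc l) p) = fps_X ^ ((l + 4) div 4) * ?w p"
      by (simp only: power_add)
  qed
  also have "\<dots> = fps_X ^ ((l + 4) div 4) * (\<Sum>p\<in>strict_parts (Suc l) m \<union> strict_parts l m. ?w p)"
    by (rule sum_distrib_left[symmetric])
  \<comment> \<open>The two sets are disjoint because their members have different numbers of
    parts.\<close>
  also have "(\<Sum>p\<in>strict_parts (Suc l) m \<union> strict_parts l m. ?w p)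
      = strict_gf (Suc l) $ m + strict_gf l $ m"
    unfolding strict_gf_nth
    by (intro sum.union_disjoint finite_strict_parts) (auto simp: strict_parts_eq)
  finally show ?thesis .
qed

lemma qvar_power: "qvar ^ n = fps_const (fps_X ^ n)"
  by (simp add: qvar_def fps_const_power)

text \<open>The coefficient recurrence says \<open>F = x * (F + F')\<close> for consecutive lengths;
  constant coefficients agree since a nonempty partition has a positive largest part.\<close>

lemma strict_gf_rec:
  fixes l :: nat
  defines "x \<equiv> zvar * qvar ^ ((l + 4) div 4)"
  shows "strict_gf (Suc l) * (1 - x) = x * strict_gf l"
proof -
  have "strict_gf (Suc l) = x * (strict_gf (Suc l) + strict_gf l)"
  proof (rule fps_ext)
    fix m
    have x: "x * g = fps_X * (fps_const (fps_X ^ ((l + 4) div 4)) * g)" for g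
      unfolding x_def zvar_def qvar_power by (rule mult.assoc)
    show "strict_gf (Suc l) $ m = (x * (strict_gf (Suc l) + strict_gf l)) $ m"
      by (cases m) (simp_all add: x strict_gf_nth_eq_0 strict_gf_nth_Suc)
  qed
  then show ?thesis
    by (simp add: algebra_simps)
qed

text \<open>The four lengths share one \<open>x\<close>, so the recurrence iterates with a fixed
  factor, and each sum of neighbours has a single monomial in \<open>x\<close> in front of
  \<open>strict_gf (4 * n)\<close>.\<close>

lemma strict_gf_block:
  fixes n :: nat
  defines "x \<equiv> zvar * qvar ^ Suc n"
  shows "(strict_gf (4 * n + 1) + strict_gf (4 * n + 2)) * (1 - x) ^ 2 = x * strict_gf (4 * n)"
    and "(strict_gf (4 * n + 3) + strict_gf (4 * n + 4)) * (1 - x) ^ 4 = x ^ 3 * strict_gf (4 * n)"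
    and "strict_gf (4 * n + 4) * (1 - x) ^ 4 = x ^ 4 * strict_gf (4 * n)"
proof -
  have d: "(4 * n + 4) div 4 = Suc n" "(4 * n + 1 + 4) div 4 = Suc n"
    "(4 * n + 2 + 4) div 4 = Suc n" "(4 * n + 3 + 4) div 4 = Suc n"
    by linarith+
  have s: "Suc (4 * n) = 4 * n + 1" "Suc (4 * n + 1) = 4 * n + 2"
    "Suc (4 * n + 2) = 4 * n + 3" "Suc (4 * n + 3) = 4 * n + 4"
    by simp_all
  have r1: "strict_gf (4 * n + 1) * (1 - x) = x * strict_gf (4 * n)"
    using strict_gf_rec[of "4 * n"] unfolding d s x_def .
  have r2: "strict_gf (4 * n + 2) * (1 - x) = x * strict_gf (4 * n + 1)"
    using strict_gf_rec[of "4 * n + 1"] unfolding d s x_def .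
  have r3: "strict_gf (4 * n + 3) * (1 - x) = x * strict_gf (4 * n + 2)"
    using strict_gf_rec[of "4 * n + 2"] unfolding d s x_def .
  have r4: "strict_gf (4 * n + 4) * (1 - x) = x * strict_gf (4 * n + 3)"
    using strict_gf_rec[of "4 * n + 3"] unfolding d s x_def .
  \<comment> \<open>With \<open>F\<close> the function of the shorter length, the recurrence turns
    the left side into \<open>F * (1 - x) + x * F = F\<close>.\<close>
  have p12: "(strict_gf (4 * n + 1) + strict_gf (4 * n + 2)) * (1 - x) = strict_gf (4 * n + 1)"
    unfolding distrib_right r2 by (simp add: algebra_simps)
  have p34: "(strict_gf (4 * n + 3) + strict_gf (4 * n + 4)) * (1 - x) = strict_gf (4 * n + 3)"
    unfolding distrib_right r4 by (simp add: algebra_simps)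
  \<comment> \<open>Left-nested products make \<open>g * (1 - x)\<close> occur literally, so that
    the recurrences can rewrite it.\<close>
  have pow: "g * c ^ 2 = g * c * c" "g * c ^ 3 = g * c * c * c" "g * c ^ 4 = g * c * c * c * c"
    for g c :: "rat fps fps"
    by (simp_all add: eval_nat_numeral mult_ac)
  have c3: "strict_gf (4 * n + 3) * (1 - x) ^ 3 = x ^ 3 * strict_gf (4 * n)"
  proof -
    have "strict_gf (4 * n + 3) * (1 - x) ^ 3 = x * (strict_gf (4 * n + 2) * (1 - x)) * (1 - x)"
      unfolding pow r3 by (simp only: mult.assoc)
    also have "\<dots> = x * x * (strict_gf (4 * n + 1) * (1 - x))"
      unfolding r2 by (simp only: mult.assoc)
    also have "\<dots> = x ^ 3 * strict_gf (4 * n)"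
      unfolding r1 by (simp only: mult.assoc power3_eq_cube)
    finally show ?thesis .
  qed
  show "(strict_gf (4 * n + 1) + strict_gf (4 * n + 2)) * (1 - x) ^ 2 = x * strict_gf (4 * n)"
    unfolding pow p12 r1 ..
  show "(strict_gf (4 * n + 3) + strict_gf (4 * n + 4)) * (1 - x) ^ 4 = x ^ 3 * strict_gf (4 * n)"
    unfolding pow p34 c3[symmetric] ..
  have "strict_gf (4 * n + 4) * (1 - x) ^ 4 = x * (strict_gf (4 * n + 3) * (1 - x) ^ 3)"
    unfolding pow r4 by (simp only: mult.assoc)
  also have "\<dots> = x ^ 4 * strict_gf (4 * n)"
    unfolding c3 by (simp add: eval_nat_numeral mult.assoc)
  finally show "strict_gf (4 * n + 4) * (1 - x) ^ 4 = x ^ 4 * strict_gf (4 * n)" .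
qed

section \<open>Closed forms with q-Pochhammer denominators\<close>

text \<open>The new factor is the \<open>1 - x\<close> of block \<open>n\<close>, so the block
  relations build up the denominators.\<close>

lemma qpoch_qz_Suc:
  "qpoch (qvar * zvar) qvar (Suc n) = qpoch (qvar * zvar) qvar n * (1 - zvar * qvar ^ Suc n)"
  by (simp add: qpoch_def mult_ac)

text \<open>The j-th block contributes \<open>(x / (1 - x))^4\<close> with \<open>x = z q^j\<close>;
  the exponents of q add up to \<open>4 (1 + ... + n) = 2 n (n + 1)\<close>.\<close>

lemma strict_gf_mult4:
  "strict_gf (4 * n) * qpoch (qvar * zvar) qvar n ^ 4 = zvar ^ (4 * n) * qvar ^ (2 * n * Suc n)"
proof (induction n)
  case 0
  show ?case by (simp add: strict_gf_0 qpoch_def)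
next
  case (Suc n)
  let ?P = "qpoch (qvar * zvar) qvar n" and ?x = "zvar * qvar ^ Suc n"
  have "strict_gf (4 * Suc n) * qpoch (qvar * zvar) qvar (Suc n) ^ 4
      = (strict_gf (4 * n + 4) * (1 - ?x) ^ 4) * ?P ^ 4"
    unfolding qpoch_qz_Suc power_mult_distrib by (simp only: mult_ac) (simp add: add.commute)
  also have "\<dots> = ?x ^ 4 * (strict_gf (4 * n) * ?P ^ 4)"
    unfolding strict_gf_block by (simp only: mult_ac)
  also have "\<dots> = zvar ^ (4 + 4 * n) * qvar ^ (Suc n * 4 + 2 * n * Suc n)"
    unfolding Suc.IH power_mult_distrib power_add power_mult[symmetric] by (simp only: mult_ac)
  also have "Suc n * 4 + 2 * n * Suc n = 2 * Suc n * Suc (Suc n)"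
    by simp
  also have "4 + 4 * n = 4 * Suc n"
    by simp
  finally show ?case .
qed

lemma choose_two_odd: "(2 * n + 1) choose 2 = n * (2 * n + 1)"
  by (simp add: choose_two)

lemma choose_two_even: "(2 * n) choose 2 = n * (2 * n - 1)"
  by (simp add: choose_two)

text \<open>Reduces each quotient in the identities to a division-free product.\<close>

lemma eq_divide_of_const_1:
  fixes f g h :: "rat fps fps"
  assumes "g $ 0 = 1" "h * g = f"
  shows "f / g = h"
proof -
  have "g \<noteq> 0" using assms(1) by auto
  moreover have "f / g * g = h * g"
    using divide_mult_cancel_const_1[OF assms(1)] assms(2) by simp
  ultimately show ?thesis by simp
qed

text \<open>For \<open>n = k + 1\<close> these are the last two lengths of block \<open>k\<close>;
  the preceding blocks enter through \<open>strict_gf (4 * k)\<close>.\<close>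

lemma strict_gf_pair_0_3:
  assumes "n \<ge> 1"
  shows "qvar ^ ((2 * n + 1) choose 2) * zvar ^ (4 * n - 1) / qpoch (qvar * zvar) qvar n ^ 4
    = strict_gf (4 * n - 1) + strict_gf (4 * n)"
proof (rule eq_divide_of_const_1)
  show "(qpoch (qvar * zvar) qvar n ^ 4) $ 0 = 1"
    by (simp add: fps_power_zeroth qpoch_qz_nth_0)
  obtain k where n: "n = Suc k" using assms by (cases n) auto
  let ?P = "qpoch (qvar * zvar) qvar k" and ?x = "zvar * qvar ^ Suc k"
  have i: "4 * n - 1 = 4 * k + 3" "4 * n = 4 * k + 4"
    using n by simp_all
  have "(strict_gf (4 * n - 1) + strict_gf (4 * n)) * qpoch (qvar * zvar) qvar n ^ 4
      = ((strict_gf (4 * k + 3) + strict_gf (4 * k + 4)) * (1 - ?x) ^ 4) * ?P ^ 4"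
    unfolding i(1) unfolding i(2)[symmetric] n qpoch_qz_Suc power_mult_distrib
    by (simp only: mult_ac)
  also have "\<dots> = ?x ^ 3 * (strict_gf (4 * k) * ?P ^ 4)"
    unfolding strict_gf_block by (simp only: mult_ac)
  also have "\<dots> = qvar ^ (Suc k * 3 + 2 * k * Suc k) * zvar ^ (3 + 4 * k)"
    unfolding strict_gf_mult4 power_mult_distrib power_add power_mult[symmetric]
    by (simp only: mult_ac)
  \<comment> \<open>Both sides equal \<open>(k + 1) (2 k + 3)\<close>.\<close>
  also have "Suc k * 3 + 2 * k * Suc k = (2 * n + 1) choose 2"
    unfolding choose_two_odd n by (simp add: algebra_simps)
  also have "3 + 4 * k = 4 * n - 1"
    using n by simp
  finally show "(strict_gf (4 * n - 1) + strict_gf (4 * n)) * qpoch (qvar * zvar) qvar n ^ 4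
      = qvar ^ ((2 * n + 1) choose 2) * zvar ^ (4 * n - 1)" .
qed

text \<open>The first two lengths of block \<open>k\<close> bring in only \<open>(1 - x)^2\<close>,
  so just two of the four Pochhammer factors advance from \<open>n - 1\<close> to
  \<open>n\<close>.\<close>

lemma strict_gf_pair_1_2:
  assumes "n \<ge> 1"
  shows "qvar ^ ((2 * n) choose 2) * zvar ^ (4 * n - 3)
      / (qpoch (qvar * zvar) qvar n ^ 2 * qpoch (qvar * zvar) qvar (n - 1) ^ 2)
    = strict_gf (4 * n - 3) + strict_gf (4 * n - 2)"
proof (rule eq_divide_of_const_1)
  show "(qpoch (qvar * zvar) qvar n ^ 2 * qpoch (qvar * zvar) qvar (n - 1) ^ 2) $ 0 = 1"
    by (simp add: fps_power_zeroth qpoch_qz_nth_0)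
  obtain k where n: "n = Suc k" using assms by (cases n) auto
  let ?P = "qpoch (qvar * zvar) qvar k" and ?x = "zvar * qvar ^ Suc k"
  have i: "4 * n - 3 = 4 * k + 1" "4 * n - 2 = 4 * k + 2" "n - 1 = k"
    using n by simp_all
  have p4: "?P ^ 4 = ?P ^ 2 * ?P ^ 2"
    by (simp flip: power_add)
  have "(strict_gf (4 * n - 3) + strict_gf (4 * n - 2))
        * (qpoch (qvar * zvar) qvar n ^ 2 * qpoch (qvar * zvar) qvar (n - 1) ^ 2)
      = ((strict_gf (4 * k + 1) + strict_gf (4 * k + 2)) * (1 - ?x) ^ 2) * ?P ^ 4"
    unfolding i p4 unfolding n qpoch_qz_Suc power_mult_distrib by (simp only: mult_ac)
  also have "\<dots> = ?x * (strict_gf (4 * k) * ?P ^ 4)"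
    unfolding strict_gf_block by (simp only: mult_ac)
  also have "\<dots> = qvar ^ (Suc k + 2 * k * Suc k) * zvar ^ (1 + 4 * k)"
    unfolding strict_gf_mult4 power_add power_one_right by (simp only: mult_ac)
  \<comment> \<open>Both sides equal \<open>(k + 1) (2 k + 1)\<close>.\<close>
  also have "Suc k + 2 * k * Suc k = (2 * n) choose 2"
    unfolding choose_two_even n by (simp add: algebra_simps)
  also have "1 + 4 * k = 4 * n - 3"
    using n by simp
  finally show "(strict_gf (4 * n - 3) + strict_gf (4 * n - 2))
        * (qpoch (qvar * zvar) qvar n ^ 2 * qpoch (qvar * zvar) qvar (n - 1) ^ 2)
      = qvar ^ ((2 * n) choose 2) * zvar ^ (4 * n - 3)" .
qed

section \<open>Infinite sums over partitions and over n\<close>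

lemma partition_weight_nth:
  "(zvar ^ p 0 * qvar ^ e) $ m = (if p 0 = m then fps_X ^ e else 0)"
  by (simp add: zvar_def qvar_power fps_X_power_nth)

text \<open>The coefficient of z^m collects the partitions with largest part \<open>m\<close>,
  sorted by length. Lengths above \<open>m\<close> contribute 0; the bound \<open>4 * m\<close> lets
  the range end together with a block of four lengths.\<close>

lemma has_sum_partition_weights:
  "((\<lambda>p. zvar ^ p 0 * qvar ^ every_fourth_sum p) has_sum
     Abs_fps (\<lambda>m. \<Sum>l | l \<le> 4 * m \<and> l mod 4 \<in> R. strict_gf l $ m))
   {p \<in> distinct_partitions. num_parts p mod 4 \<in> R}"
proof (rule has_sum_fps_supersetI[where
      B = "\<lambda>m. {p \<in> distinct_partitions. num_parts p mod 4 \<in> R \<and> p 0 = m}"])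
  fix m
  define L where "L = {l. l \<le> 4 * m \<and> l mod 4 \<in> R}"
  have "finite L" by (simp add: L_def)
  define B where "B = {p \<in> distinct_partitions. num_parts p mod 4 \<in> R \<and> p 0 = m}"
  have "num_parts p \<le> m" if "p \<in> B" for p
  proof -
    have "p \<in> strict_parts (num_parts p) m"
      using that by (simp add: strict_parts_eq B_def)
    then show ?thesis
      using strict_parts_empty[of m "num_parts p"] by fastforce
  qed
  then have B: "B = (\<Union>l\<in>L. strict_parts l m)"
    by (fastforce simp: B_def L_def strict_parts_eq)
  show "finite {p \<in> distinct_partitions. num_parts p mod 4 \<in> R \<and> p 0 = m}"
    using B \<open>finite L\<close> by (simp add: finite_strict_parts flip: B_def)
  have "(\<Sum>p\<in>B. (zvar ^ p 0 * qvar ^ every_fourth_sum p) $ m)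
      = (\<Sum>p\<in>B. fps_X ^ every_fourth_sum p)"
    by (rule sum.cong) (auto simp: partition_weight_nth B_def)
  also have "\<dots> = (\<Sum>l\<in>L. strict_gf l $ m)"
    unfolding B strict_gf_nth using \<open>finite L\<close>
    by (intro sum.UNION_disjoint) (use finite_strict_parts in \<open>auto simp: strict_parts_eq\<close>)
  finally show "(\<Sum>p | p \<in> distinct_partitions \<and> num_parts p mod 4 \<in> R \<and> p 0 = m.
        (zvar ^ p 0 * qvar ^ every_fourth_sum p) $ m)
      = Abs_fps (\<lambda>m. \<Sum>l | l \<le> 4 * m \<and> l mod 4 \<in> R. strict_gf l $ m) $ m"
    by (simp add: B_def L_def)
qed (auto simp: partition_weight_nth)

text \<open>The bounds make the n-th term divisible by z^n, so only \<open>n \<le> m\<close> reaches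
  the coefficient of z^m.\<close>

lemma has_sum_strict_gf_pairs:
  fixes a b :: "nat \<Rightarrow> nat"
  assumes "\<And>n. n \<ge> 1 \<Longrightarrow> n \<le> a n" "\<And>n. n \<ge> 1 \<Longrightarrow> n \<le> b n"
  shows "((\<lambda>n. strict_gf (a n) + strict_gf (b n)) has_sum
     Abs_fps (\<lambda>m. \<Sum>n=1..m. strict_gf (a n) $ m + strict_gf (b n) $ m)) {1..}"
proof (rule has_sum_fps_supersetI[where B = "\<lambda>m. {1..m}"])
  fix m n :: nat assume "n \<in> {1..} - {1..m}"
  then have "m < n" "n \<ge> 1" by auto
  then show "(strict_gf (a n) + strict_gf (b n)) $ m = 0"
    using assms[of n] by (simp add: strict_gf_nth_eq_0)
qed auto

section \<open>Splitting lengths by residue modulo 4\<close>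

text \<open>Offsets run over 1 to 4 rather than 0 to 3 to match the blocks with a common exponent of
  q. Length 0 stands alone.\<close>

lemma sum_mod_4_blocks:
  fixes h :: "nat \<Rightarrow> 'a::comm_monoid_add"
  shows "(\<Sum>l | l \<le> 4 * N \<and> l mod 4 \<in> R. h l)
    = (if 0 \<in> R then h 0 else 0) + (\<Sum>n=1..N. \<Sum>d | d \<in> {1..4} \<and> d mod 4 \<in> R. h (4 * n - 4 + d))"
proof (induction N)
  case 0
  have "{l::nat. l \<le> 4 * 0 \<and> l mod 4 \<in> R} = (if 0 \<in> R then {0} else {})" by auto
  then show ?case by (simp only:) simp
next
  case (Suc N)
  let ?A = "{l. l \<le> 4 * N \<and> l mod 4 \<in> R}" and ?D = "{d. d \<in> {1..4} \<and> d mod 4 \<in> R}"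
  have "{l. l \<le> 4 * Suc N \<and> l mod 4 \<in> R} = ?A \<union> (\<lambda>d. 4 * N + d) ` ?D"
  proof (intro set_eqI iffI)
    fix l assume l: "l \<in> {l. l \<le> 4 * Suc N \<and> l mod 4 \<in> R}"
    show "l \<in> ?A \<union> (\<lambda>d. 4 * N + d) ` ?D"
    proof (cases "l \<le> 4 * N")
      case False
      then have eq: "l = 4 * N + (l - 4 * N)" by simp
      then have "l mod 4 = (l - 4 * N) mod 4" by (metis mod_mult_self4)
      then have "l - 4 * N \<in> ?D" using l False by auto
      then show ?thesis using eq by blast
    qed (use l in auto)
  qed auto
  moreover have "?A \<inter> (\<lambda>d. 4 * N + d) ` ?D = {}" by auto
  ultimately have "sum h {l. l \<le> 4 * Suc N \<and> l mod 4 \<in> R} = sum h ?A + (\<Sum>d\<in>?D. h (4 * N + d))"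
    by (simp add: sum.union_disjoint sum.reindex inj_on_def)
  then show ?case
    unfolding Suc.IH by (simp add: add.assoc)
qed

lemma sum_mod_4_0_3:
  fixes h :: "nat \<Rightarrow> 'a::comm_monoid_add"
  shows "(\<Sum>l | l \<le> 4 * N \<and> l mod 4 \<in> {0, 3}. h l) = h 0 + (\<Sum>n=1..N. h (4 * n - 1) + h (4 * n))"
proof -
  have "{1..4::nat} = {1, 2, 3, 4}"
    by auto
  \<comment> \<open>Residue 0 is represented by the offset 4.\<close>
  then have D: "{d::nat. d \<in> {1..4} \<and> d mod 4 \<in> {0, 3}} = {3, 4}"
    by auto
  have "4 * n - 4 + 3 = 4 * n - 1" "4 * n - 4 + 4 = 4 * n" if "n \<in> {1..N}" for n
    using that by auto
  then show ?thesis
    unfolding sum_mod_4_blocks D by simp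
qed

lemma sum_mod_4_1_2:
  fixes h :: "nat \<Rightarrow> 'a::comm_monoid_add"
  shows "(\<Sum>l | l \<le> 4 * N \<and> l mod 4 \<in> {1, 2}. h l) = (\<Sum>n=1..N. h (4 * n - 3) + h (4 * n - 2))"
proof -
  have "{1..4::nat} = {1, 2, 3, 4}"
    by auto
  then have D: "{d::nat. d \<in> {1..4} \<and> d mod 4 \<in> {1, 2}} = {1, 2}"
    by auto
  have "4 * n - 4 + 1 = 4 * n - 3" "4 * n - 4 + 2 = 4 * n - 2" if "n \<in> {1..N}" for n
    using that by auto
  then show ?thesis
    unfolding sum_mod_4_blocks D by simp
qed

theorem theorem3:
  shows
    "((\<lambda>p. zvar ^ p 0 * qvar ^ every_fourth_sum p) summable_on
       {p \<in> distinct_partitions. num_parts p mod 4 \<in> {0, 3}}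
     \<and> (\<lambda>n. qvar ^ ((2 * n + 1) choose 2) * zvar ^ (4 * n - 1) / qpoch (qvar * zvar) qvar n ^ 4)
       summable_on {1..}
     \<and> (\<Sum>\<^sub>\<infinity>p\<in>{p \<in> distinct_partitions. num_parts p mod 4 \<in> {0, 3}}.
          zvar ^ p 0 * qvar ^ every_fourth_sum p)
       = 1 + (\<Sum>\<^sub>\<infinity>n\<in>{1..}.
          qvar ^ ((2 * n + 1) choose 2) * zvar ^ (4 * n - 1) / qpoch (qvar * zvar) qvar n ^ 4))
     \<and>
     ((\<lambda>p. zvar ^ p 0 * qvar ^ every_fourth_sum p) summable_on
       {p \<in> distinct_partitions. num_parts p mod 4 \<in> {1, 2}}
     \<and> (\<lambda>n. qvar ^ ((2 * n) choose 2) * zvar ^ (4 * n - 3)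
            / (qpoch (qvar * zvar) qvar n ^ 2 * qpoch (qvar * zvar) qvar (n - 1) ^ 2))
       summable_on {1..}
     \<and> (\<Sum>\<^sub>\<infinity>p\<in>{p \<in> distinct_partitions. num_parts p mod 4 \<in> {1, 2}}.
          zvar ^ p 0 * qvar ^ every_fourth_sum p)
       = (\<Sum>\<^sub>\<infinity>n\<in>{1..}.
          qvar ^ ((2 * n) choose 2) * zvar ^ (4 * n - 3)
            / (qpoch (qvar * zvar) qvar n ^ 2 * qpoch (qvar * zvar) qvar (n - 1) ^ 2)))"
proof -
  let ?w = "\<lambda>p. zvar ^ p 0 * qvar ^ every_fourth_sum p"
  let ?t = "\<lambda>n. qvar ^ ((2 * n + 1) choose 2) * zvar ^ (4 * n - 1) / qpoch (qvar * zvar) qvar n ^ 4"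
  let ?u = "\<lambda>n. qvar ^ ((2 * n) choose 2) * zvar ^ (4 * n - 3)
            / (qpoch (qvar * zvar) qvar n ^ 2 * qpoch (qvar * zvar) qvar (n - 1) ^ 2)"
  \<comment> \<open>\<open>T\<close> and \<open>U\<close> are the coefficientwise limits to which
    both sides are evaluated.\<close>
  define T where "T = Abs_fps (\<lambda>m. \<Sum>n=1..m. strict_gf (4 * n - 1) $ m + strict_gf (4 * n) $ m)"
  define U where "U = Abs_fps (\<lambda>m. \<Sum>n=1..m. strict_gf (4 * n - 3) $ m + strict_gf (4 * n - 2) $ m)"
  have "((\<lambda>n. strict_gf (4 * n - 1) + strict_gf (4 * n)) has_sum T) {1..}"
    unfolding T_def by (rule has_sum_strict_gf_pairs) auto
  then have t: "(?t has_sum T) {1..}"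
    by (subst has_sum_cong[OF strict_gf_pair_0_3]) auto
  have "((\<lambda>n. strict_gf (4 * n - 3) + strict_gf (4 * n - 2)) has_sum U) {1..}"
    unfolding U_def by (rule has_sum_strict_gf_pairs) auto
  then have u: "(?u has_sum U) {1..}"
    by (subst has_sum_cong[OF strict_gf_pair_1_2]) auto
  \<comment> \<open>The isolated length 0, the empty partition, supplies the summand 1.\<close>
  have "Abs_fps (\<lambda>m. \<Sum>l | l \<le> 4 * m \<and> l mod 4 \<in> {0, 3}. strict_gf l $ m) = 1 + T"
    unfolding sum_mod_4_0_3 by (rule fps_ext) (simp add: T_def strict_gf_0)
  then have p: "(?w has_sum (1 + T)) {p \<in> distinct_partitions. num_parts p mod 4 \<in> {0, 3}}"
    using has_sum_partition_weights[of "{0, 3}"] by simp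
  have "Abs_fps (\<lambda>m. \<Sum>l | l \<le> 4 * m \<and> l mod 4 \<in> {1, 2}. strict_gf l $ m) = U"
    unfolding sum_mod_4_1_2 U_def ..
  then have r: "(?w has_sum U) {p \<in> distinct_partitions. num_parts p mod 4 \<in> {1, 2}}"
    using has_sum_partition_weights[of "{1, 2}"] by simp
  \<comment> \<open>\<open>has_sum\<close> gives summability along with the value, so no default
    value of a divergent sum is involved.\<close>
  show ?thesis
    using t u p r by (simp only: infsumI has_sum_imp_summable simp_thms)
qed

end
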